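(* Let $\mathcal{Y}=\mathbb{P}^1_{\mathbb{Z}}\setminus\{0,1,\infty\}$ and let $s$ be a non-negative integer. Then for every set $S$ of primes with $\#S=s$, we have $\#\mathcal{Y}(\mathbb{Z}_S)\leq 8\cdot 6^s\cdot 2^{4^s}$.
   Context: $\mathbb{Z}_S$ is the ring of $S$-integers; $\mathcal{Y}(\mathbb{Z}_S)$ is the set of $x\in\mathbb{Z}_S^\times$ with $1-x\in\mathbb{Z}_S^\times$ (solutions of the $S$-unit equation). *)

theory Defs
  imports Complex_Main "HOL-Computational_Algebra.Primes"
begin

definition S_integers :: "nat set \<Rightarrow> rat set" where
  "S_integers S =
    {of_int a / of_nat b | a b. b \<noteq> 0 \<and> (\<forall>p. prime p \<longrightarrow> p dvd b \<longrightarrow> p \<in> S)}"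

definition S_units :: "nat set \<Rightarrow> rat set" where
  "S_units S = {x \<in> S_integers S. \<exists>y \<in> S_integers S. x * y = 1}"

(* The Z_S-points of P^1 minus {0, 1, infinity}, in the affine coordinate x:
   the solutions of the S-unit equation x + (1 - x) = 1. *)
definition thrice_punctured_line_points :: "nat set \<Rightarrow> rat set" where
  "thrice_punctured_line_points S = {x \<in> S_units S. 1 - x \<in> S_units S}"

end

theory Submission imports Defs "HOL-Analysis.Analysis" begin

text \<open>
  Clearing denominators and permuting \<open>0, 1, \<infinity>\<close>, solutions correspond to coprime positive
  \<open>a + b = c\<close> with all primes in \<open>S\<close>, up to a factor 3. The integrals of
  \<open>w\<^sup>i (w - a)\<^sup>j (c - w)\<^sup>k\<close> over \<open>[0, a]\<close>, \<open>[a, c]\<close> and \<open>[0, c]\<close> are, up to a common factor,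
  \<open>a^(i+j+1)\<close>, \<open>b^(j+k+1)\<close> and \<open>c^(i+k+1)\<close> times integers, which gives explicit Pade relations
  between \<open>a^m, b^m, c^m\<close> with \<open>m = 2N + 1\<close> and coefficients of size about \<open>c^N\<close>. Comparing
  such a relation with a second solution \<open>v\<close> shows, as in the work of Beukers and Schlickewei, that
  the exponent vector of \<open>v\<close> cannot be close to \<open>m\<close> times that of \<open>u = (a, b, c)\<close>. Hence
  solutions whose normalised exponent vectors lie in one small cell have sizes in a
  bounded range, and the trivial relation \<open>a + b = c\<close> (the case \<open>m = 1\<close>) forces
  consecutive sizes to grow geometrically. It remains to count cells.
\<close>

section \<open>Beta integrals and the Pade identity\<close>

text \<open>Induction on \<open>n\<close> by integration by parts: \<open>F\<close> vanishes at both
  endpoints, so its derivative integrates to 0. This trades a factor \<open>q - w\<close> for a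
  factor \<open>w - p\<close>, which is why \<open>m\<close> has to stay arbitrary.\<close>

lemma has_integral_beta_interval:
  fixes p q :: real
  assumes "p \<le> q"
  shows "((\<lambda>w. (w - p) ^ m * (q - w) ^ n) has_integral
    (q - p) ^ (m + n + 1) * fact m * fact n / fact (m + n + 1)) {p..q}"
proof (induction n arbitrary: m)
  case 0
  have "((\<lambda>w. (w - p) ^ m) has_integral
      ((q - p) ^ Suc m / real (Suc m) - (p - p) ^ Suc m / real (Suc m))) {p..q}"
  proof (rule fundamental_theorem_of_calculus[OF assms])
    fix x assume "x \<in> {p..q}"
    have "((\<lambda>w. (w - p) ^ Suc m / real (Suc m)) has_real_derivative
        (real (Suc m) * (x - p) ^ m * 1) / real (Suc m)) (at x within {p..q})"
      by (rule derivative_eq_intros refl | simp)+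
    then show "((\<lambda>w. (w - p) ^ Suc m / real (Suc m)) has_vector_derivative (x - p) ^ m)
        (at x within {p..q})"
      by (simp add: has_real_derivative_iff_has_vector_derivative)
  qed
  moreover have "(q - p) ^ Suc m / real (Suc m) - (p - p) ^ Suc m / real (Suc m) =
      (q - p) ^ (m + 0 + 1) * fact m * fact 0 / fact (m + 0 + 1)"
    by (simp del: of_nat_Suc)
  ultimately show ?case
    by simp
next
  case (Suc n)
  define F where "F w = (w - p) ^ Suc m * (q - w) ^ Suc n" for w
  have "((\<lambda>w. real (Suc m) * (w - p) ^ m * (q - w) ^ Suc n
      - real (Suc n) * (w - p) ^ Suc m * (q - w) ^ n) has_integral (F q - F p)) {p..q}"
  proof (rule fundamental_theorem_of_calculus[OF assms])
    fix x assume "x \<in> {p..q}"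
    have "(F has_real_derivative real (Suc m) * (x - p) ^ m * (q - x) ^ Suc n
      - real (Suc n) * (x - p) ^ Suc m * (q - x) ^ n) (at x within {p..q})"
      unfolding F_def
      by (rule derivative_eq_intros refl | simp add: algebra_simps)+
    then show "(F has_vector_derivative real (Suc m) * (x - p) ^ m * (q - x) ^ Suc n
      - real (Suc n) * (x - p) ^ Suc m * (q - x) ^ n) (at x within {p..q})"
      by (simp add: has_real_derivative_iff_has_vector_derivative)
  qed
  moreover have "F q - F p = 0"
    by (simp add: F_def)
  ultimately have "((\<lambda>w. real (Suc m) * (w - p) ^ m * (q - w) ^ Suc n
      - real (Suc n) * (w - p) ^ Suc m * (q - w) ^ n) has_integral 0) {p..q}"
    by simp
  from has_integral_add[OF this has_integral_mult_right[OF Suc.IH[of "Suc m"], of "real (Suc n)"]]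
  have "((\<lambda>w. real (Suc m) * ((w - p) ^ m * (q - w) ^ Suc n)) has_integral
      real (Suc n) * ((q - p) ^ (Suc m + n + 1) * fact (Suc m) * fact n / fact (Suc m + n + 1))) {p..q}"
    by (simp add: algebra_simps)
  from has_integral_mult_right[OF this, of "1 / real (Suc m)"] 
  have "((\<lambda>w. (w - p) ^ m * (q - w) ^ Suc n) has_integral
      1 / real (Suc m) * (real (Suc n) *
        ((q - p) ^ (Suc m + n + 1) * fact (Suc m) * fact n / fact (Suc m + n + 1)))) {p..q}"
    by (simp del: of_nat_Suc)
  moreover have "1 / real (Suc m) * (real (Suc n) *
        ((q - p) ^ (Suc m + n + 1) * fact (Suc m) * fact n / fact (Suc m + n + 1)))
     = (q - p) ^ (m + Suc n + 1) * fact m * fact (Suc n) / fact (m + Suc n + 1)"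
    by (simp del: of_nat_Suc)
  ultimately show ?case by (simp only:)
qed

text \<open>What remains of the integral of
  \<open>(w - p) ^ i * (q - w) ^ j * (d + (w - p)) ^ k\<close> over \<open>[p, q]\<close>, with
  \<open>x = q - p\<close>, once the factorials and the power of \<open>x\<close> are split off. The
  coefficients are natural numbers, so the same formula serves over the reals (integration) and over
  the integers (divisibility).\<close>

definition pade_poly :: "nat \<Rightarrow> nat \<Rightarrow> nat \<Rightarrow> 'a::comm_semiring_1 \<Rightarrow> 'a \<Rightarrow> 'a" where
  "pade_poly i j k d x =
    (\<Sum>l\<le>k. of_nat (((i + l) choose l) * ((i + j + k + 1) choose (k - l))) * d ^ (k - l) * x ^ l)"

text \<open>Expanding the third factor binomially gives one Beta value per \<open>l\<close>.
  Cancelling factorials shows that all of them share a factor free of \<open>l\<close>, and the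
  cofactors are integers.\<close>

lemma pade_coeff:
  assumes "l \<le> k"
  shows "real (k choose l) * (fact (i + l) * fact j / fact (i + j + l + 1)) =
    real (((i + l) choose l) * ((i + j + k + 1) choose (k - l))) *
    (fact i * fact j * fact k / fact (i + j + k + 1))"
proof -
  have 1: "real (k choose l) = fact k / (fact l * fact (k - l))"
    using assms by (rule binomial_fact)
  have 2: "real ((i + l) choose l) = fact (i + l) / (fact l * fact i)"
    using binomial_fact[of l "i + l", where 'a = real] by simp
  have "i + j + k + 1 - (k - l) = i + j + l + 1"
    using assms by simp
  with binomial_fact[of "k - l" "i + j + k + 1", where 'a = real]
  have 3: "real ((i + j + k + 1) choose (k - l)) =
      fact (i + j + k + 1) / (fact (k - l) * fact (i + j + l + 1))"
    by (simp only:)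
  show ?thesis
    unfolding of_nat_mult 1 2 3
    by (simp add: field_simps del: fact_Suc)
qed

lemma has_integral_pade_poly:
  fixes p q d :: real
  assumes "p \<le> q"
  shows "((\<lambda>w. (w - p) ^ i * (q - w) ^ j * (d + (w - p)) ^ k) has_integral
    fact i * fact j * fact k / fact (i + j + k + 1) *
      ((q - p) ^ (i + j + 1) * pade_poly i j k d (q - p))) {p..q}"
proof -
  let ?c = "\<lambda>l. real (k choose l) * d ^ (k - l)"
  have "((\<lambda>w. \<Sum>l\<le>k. ?c l * ((w - p) ^ (i + l) * (q - w) ^ j)) has_integral
      (\<Sum>l\<le>k. ?c l * ((q - p) ^ (i + l + j + 1) * fact (i + l) * fact j / fact (i + l + j + 1)))) {p..q}"
    by (intro has_integral_sum finite_atMost has_integral_mult_right has_integral_beta_interval assms)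
  moreover have "(\<Sum>l\<le>k. ?c l * ((w - p) ^ (i + l) * (q - w) ^ j)) =
      (w - p) ^ i * (q - w) ^ j * (d + (w - p)) ^ k" for w
    unfolding add.commute[of d] binomial_ring[of "w - p" d k] sum_distrib_left
    by (intro sum.cong refl) (simp add: power_add)
  moreover have "(\<Sum>l\<le>k. ?c l * ((q - p) ^ (i + l + j + 1) * fact (i + l) * fact j / fact (i + l + j + 1))) =
      fact i * fact j * fact k / fact (i + j + k + 1) *
      ((q - p) ^ (i + j + 1) * pade_poly i j k d (q - p))"
    unfolding pade_poly_def sum_distrib_left
  proof (intro sum.cong refl)
    fix l assume "l \<in> {..k}"
    then have "l \<le> k" by simp
    have e: "i + l + j + 1 = i + j + l + 1" "(q - p) ^ (i + j + l + 1) = (q - p) ^ (i + j + 1) * (q - p) ^ l"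
      by (simp_all add: power_add)
    have "?c l * ((q - p) ^ (i + l + j + 1) * fact (i + l) * fact j / fact (i + l + j + 1)) =
      (real (k choose l) * (fact (i + l) * fact j / fact (i + j + l + 1))) * (d ^ (k - l) * ((q - p) ^ (i + j + 1) * (q - p) ^ l))"
      unfolding e by simp
    also have "\<dots> = fact i * fact j * fact k / fact (i + j + k + 1) * ((q - p) ^ (i + j + 1) *
        (real (((i + l) choose l) * ((i + j + k + 1) choose (k - l))) * d ^ (k - l) * (q - p) ^ l))"
      unfolding pade_coeff[OF \<open>l \<le> k\<close>] by (simp only: mult.assoc mult.commute mult.left_commute)
    finally show "?c l * ((q - p) ^ (i + l + j + 1) * fact (i + l) * fact j / fact (i + l + j + 1)) = \<dots>" .
  qed
  ultimately show ?thesis by simp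
qed

text \<open>The substitution of \<open>- w\<close> for \<open>w\<close>. On \<open>[0, a]\<close>
  the factor \<open>c - w\<close> is \<open>b + (a - w)\<close>, so measuring from the right
  endpoint keeps both arguments of \<open>pade_poly\<close> positive.\<close>

lemma has_integral_pade_poly_reflected:
  fixes p q d :: real
  assumes "p \<le> q"
  shows "((\<lambda>w. (q - w) ^ i * (w - p) ^ j * (d + (q - w)) ^ k) has_integral
    fact i * fact j * fact k / fact (i + j + k + 1) *
      ((q - p) ^ (i + j + 1) * pade_poly i j k d (q - p))) {p..q}"
proof -
  let ?f = "\<lambda>w. (w - (- q)) ^ i * (- p - w) ^ j * (d + (w - (- q))) ^ k"
  have "(?f has_integral fact i * fact j * fact k / fact (i + j + k + 1) *
      ((q - p) ^ (i + j + 1) * pade_poly i j k d (q - p))) {- q..- p}"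
    using has_integral_pade_poly[of "- q" "- p" i j d k] assms by simp
  then have "((\<lambda>w. ?f (- w)) has_integral fact i * fact j * fact k / fact (i + j + k + 1) *
      ((q - p) ^ (i + j + 1) * pade_poly i j k d (q - p))) {p..q}"
    by (subst (asm) has_integral_reflect_real[symmetric]) (use assms in simp_all)
  then show ?thesis by (simp add: algebra_simps)
qed

text \<open>The integral of \<open>f\<close> over \<open>[0, a + b]\<close> is split at
  \<open>a\<close>. The sign comes from \<open>(w - a) ^ j\<close> on the left piece. On the whole
  interval \<open>w - a\<close> is \<open>- a + w\<close>, which puts the negative argument
  \<open>- a\<close> into the third polynomial.\<close>

lemma pade_identity_real:
  fixes a b :: real
  assumes "0 \<le> a" "0 \<le> b"
  shows "(- 1) ^ j * a ^ (i + j + 1) * pade_poly j i k b a + b ^ (j + k + 1) * pade_poly j k i a b =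
    (a + b) ^ (i + k + 1) * pade_poly i k j (- a) (a + b)"
proof -
  define f where "f w = w ^ i * (w - a) ^ j * (a + b - w) ^ k" for w
  define K :: real where "K = fact i * fact j * fact k / fact (i + j + k + 1)"
  have neg: "(w - a) ^ j = (- 1) ^ j * (a - w) ^ j" for w
    by (simp flip: power_mult_distrib)
  have "((\<lambda>w. (- 1) ^ j * ((a - w) ^ j * (w - 0) ^ i * (b + (a - w)) ^ k)) has_integral
      (- 1) ^ j * (fact j * fact i * fact k / fact (j + i + k + 1) *
      ((a - 0) ^ (j + i + 1) * pade_poly j i k b (a - 0)))) {0..a}"
    by (intro has_integral_mult_right has_integral_pade_poly_reflected assms)
  moreover have "(- 1) ^ j * ((a - w) ^ j * (w - 0) ^ i * (b + (a - w)) ^ k) = f w" for w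
    unfolding f_def neg by (simp add: algebra_simps)
  ultimately have 1: "(f has_integral K * ((- 1) ^ j * a ^ (i + j + 1) * pade_poly j i k b a)) {0..a}"
    by (simp add: K_def algebra_simps del: fact_Suc)
  have "((\<lambda>w. (w - a) ^ j * (a + b - w) ^ k * (a + (w - a)) ^ i) has_integral
      fact j * fact k * fact i / fact (j + k + i + 1) *
      ((a + b - a) ^ (j + k + 1) * pade_poly j k i a (a + b - a))) {a..a + b}"
    by (intro has_integral_pade_poly) (use assms in simp)
  then have 2: "(f has_integral K * (b ^ (j + k + 1) * pade_poly j k i a b)) {a..a + b}"
    by (simp add: K_def f_def[abs_def] algebra_simps del: fact_Suc)
  have "((\<lambda>w. (w - 0) ^ i * (a + b - w) ^ k * (- a + (w - 0)) ^ j) has_integral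
      fact i * fact k * fact j / fact (i + k + j + 1) *
      ((a + b - 0) ^ (i + k + 1) * pade_poly i k j (- a) (a + b - 0))) {0..a + b}"
    by (intro has_integral_pade_poly) (use assms in simp)
  then have 3: "(f has_integral K * ((a + b) ^ (i + k + 1) * pade_poly i k j (- a) (a + b))) {0..a + b}"
    by (simp add: K_def f_def[abs_def] algebra_simps del: fact_Suc)
  have "K * ((- 1) ^ j * a ^ (i + j + 1) * pade_poly j i k b a) + K * (b ^ (j + k + 1) * pade_poly j k i a b)
      = K * ((a + b) ^ (i + k + 1) * pade_poly i k j (- a) (a + b))"
    using has_integral_combine[OF _ _ 1 2] 3 assms by (auto intro: has_integral_unique)
  moreover have "K \<noteq> 0" by (simp add: K_def)
  ultimately show ?thesis
    by (metis (no_types, lifting) distrib_left mult_cancel_left)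
qed

lemma pade_identity:
  fixes a b :: int
  assumes "0 \<le> a" "0 \<le> b"
  shows "(- 1) ^ j * a ^ (i + j + 1) * pade_poly j i k b a + b ^ (j + k + 1) * pade_poly j k i a b =
    (a + b) ^ (i + k + 1) * pade_poly i k j (- a) (a + b)"
proof -
  have c: "of_int (pade_poly i j k d x) = (pade_poly i j k (of_int d) (of_int x) :: real)" for i j k d x
    by (simp add: pade_poly_def)
  have "real_of_int ((- 1) ^ j * a ^ (i + j + 1) * pade_poly j i k b a + b ^ (j + k + 1) * pade_poly j k i a b) =
    real_of_int ((a + b) ^ (i + k + 1) * pade_poly i k j (- a) (a + b))"
    unfolding of_int_add of_int_mult of_int_power of_int_minus of_int_1 c
    using pade_identity_real[of a b] assms by simp
  then show ?thesis by (simp only: of_int_eq_iff)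
qed

lemma pade_poly_pos:
  fixes d x :: int
  assumes "0 < d" "0 < x"
  shows "0 < pade_poly i j k d x"
  unfolding pade_poly_def by (rule sum_pos) (use assms in auto)

text \<open>The first binomial is at most \<open>2 ^ (i + k)\<close>, the second ones sum to at most
  a full row \<open>2 ^ (i + j + k + 1)\<close>, and each monomial is at most
  \<open>c ^ k\<close>.\<close>

lemma pade_poly_le:
  fixes d x c :: int
  assumes "0 \<le> d" "d \<le> c" "0 \<le> x" "x \<le> c"
  shows "pade_poly i j k d x \<le> 2 ^ (2 * i + j + 2 * k + 1) * c ^ k"
proof -
  let ?M = "i + j + k + 1"
  have "pade_poly i j k d x \<le> (\<Sum>l\<le>k. 2 ^ (i + k) * int (?M choose (k - l)) * c ^ k)"
    unfolding pade_poly_def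
  proof (rule sum_mono)
    fix l assume "l \<in> {..k}"
    then have l: "l \<le> k" by simp
    have "(i + l) choose l \<le> 2 ^ (i + l)" by (rule binomial_le_pow2)
    also have "\<dots> \<le> 2 ^ (i + k)" using l by simp
    finally have "int ((i + l) choose l) \<le> 2 ^ (i + k)"
      by (metis of_nat_le_iff of_nat_numeral of_nat_power)
    moreover have "d ^ (k - l) * x ^ l \<le> c ^ (k - l) * c ^ l"
      using assms by (intro mult_mono power_mono) auto
    moreover have "c ^ (k - l) * c ^ l = c ^ k"
      using l by (simp flip: power_add)
    ultimately show "int (((i + l) choose l) * (?M choose (k - l))) * d ^ (k - l) * x ^ l
        \<le> 2 ^ (i + k) * int (?M choose (k - l)) * c ^ k"
      unfolding of_nat_mult mult.assoc
      using assms by (intro mult_mono) auto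
  qed
  also have "\<dots> = 2 ^ (i + k) * int (\<Sum>l\<le>k. ?M choose (k - l)) * c ^ k"
    by (simp add: sum_distrib_left sum_distrib_right)
  also have "(\<Sum>l\<le>k. ?M choose (k - l)) = (\<Sum>l\<le>k. ?M choose l)"
    by (rule sum.reindex_bij_witness[of _ "\<lambda>l. k - l" "\<lambda>l. k - l"]) auto
  also have "2 ^ (i + k) * int (\<Sum>l\<le>k. ?M choose l) * c ^ k \<le> 2 ^ (i + k) * 2 ^ ?M * c ^ k"
  proof -
    have "(\<Sum>l\<le>k. ?M choose l) \<le> (\<Sum>l\<le>?M. ?M choose l)"
      by (rule sum_mono2) auto
    also have "\<dots> = 2 ^ ?M" by (rule choose_row_sum)
    finally have "int (\<Sum>l\<le>k. ?M choose l) \<le> 2 ^ ?M"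
      by (metis of_nat_le_iff of_nat_numeral of_nat_power)
    then show ?thesis using assms by (intro mult_mono) (auto intro!: sum_nonneg)
  qed
  also have "\<dots> = 2 ^ (2 * i + j + 2 * k + 1) * c ^ k"
    by (subst power_add[symmetric]) (simp add: algebra_simps)
  finally show ?thesis .
qed

section \<open>Comparing a Pade relation with a second relation\<close>

text \<open>Eliminating \<open>a ^ m\<close> between the given relation and the Pade relation, where
  \<open>m = 2 * N + 1\<close>, shows that \<open>c ^ m\<close> divides \<open>b ^ m\<close> times
  the determinant \<open>t1 * x2 + t2 * x1\<close>. As \<open>c\<close> and \<open>b\<close> are
  coprime, \<open>c ^ m\<close> divides the determinant, whose size is only about
  \<open>T * c ^ N\<close>.\<close>

lemma thue_bound:
  fixes a b t1 t2 t3 T :: int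
  assumes ab: "0 < a" "0 < b" "coprime a b" and "odd N"
    and t: "0 < t1" "t1 \<le> T" "0 < t2" "t2 \<le> T"
    and eq: "a ^ (2 * N + 1) * t1 + b ^ (2 * N + 1) * t2 = (a + b) ^ (2 * N + 1) * t3"
  shows "(a + b) ^ (N + 1) \<le> 2 ^ (5 * N + 2) * T"
proof -
  define c where "c = a + b"
  define m where "m = 2 * N + 1"
  define x1 where "x1 = pade_poly N N N b a"
  define x2 where "x2 = pade_poly N N N a b"
  define x3 where "x3 = pade_poly N N N (- a) c"
  have c: "0 < c" "a \<le> c" "b \<le> c" using ab by (simp_all add: c_def)
  have xpos: "0 < x1" "0 < x2" unfolding x1_def x2_def using ab by (auto intro: pade_poly_pos)
  have xle: "x1 \<le> 2 ^ (5 * N + 1) * c ^ N" "x2 \<le> 2 ^ (5 * N + 1) * c ^ N"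
    using pade_poly_le[of b c a N N N] pade_poly_le[of a c b N N N] ab c
    by (simp_all add: x1_def x2_def)
  have E: "- (a ^ m * x1) + b ^ m * x2 = c ^ m * x3"
    using pade_identity[of a b N N N] ab \<open>odd N\<close>
    by (simp add: x1_def x2_def x3_def c_def m_def flip: mult_2)
  have eq': "a ^ m * t1 + b ^ m * t2 = c ^ m * t3"
    using eq by (simp add: c_def m_def)
  have "b ^ m * (t1 * x2 + t2 * x1) = t1 * (- (a ^ m * x1) + b ^ m * x2) + x1 * (a ^ m * t1 + b ^ m * t2)"
    by (simp add: algebra_simps)
  also have "\<dots> = c ^ m * (t1 * x3 + x1 * t3)"
    unfolding E eq' by (simp add: algebra_simps)
  finally have "c ^ m dvd b ^ m * (t1 * x2 + t2 * x1)" by simp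
  moreover have "coprime c b"
    using ab unfolding c_def coprime_iff_gcd_eq_1 by simp
  then have "coprime (c ^ m) (b ^ m)"
    by simp
  ultimately have "c ^ m dvd t1 * x2 + t2 * x1"
    by (simp add: coprime_dvd_mult_right_iff)
  \<comment> \<open>For odd N the first coefficient of the relation E is negative, which makes this multiple positive.\<close>
  then have "c ^ m \<le> t1 * x2 + t2 * x1"
    by (rule zdvd_imp_le) (use t xpos in \<open>simp add: add_pos_pos\<close>)
  also have "\<dots> \<le> T * (2 ^ (5 * N + 1) * c ^ N) + T * (2 ^ (5 * N + 1) * c ^ N)"
    using t xle xpos by (intro add_mono mult_mono) auto
  also have "\<dots> = c ^ N * (2 ^ (5 * N + 2) * T)"
    by simp
  also have "c ^ m = c ^ N * c ^ (N + 1)"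
    unfolding m_def power_add[symmetric] by (simp add: mult_2)
  finally have "c ^ N * c ^ (N + 1) \<le> c ^ N * (2 ^ (5 * N + 2) * T)" .
  then show ?thesis
    using c by (simp add: c_def)
qed

section \<open>Coprime sums, their types and exponents\<close>

definition coprime_sums :: "nat set \<Rightarrow> (nat \<times> nat) set" where
  "coprime_sums S = {(a, b). 0 < a \<and> 0 < b \<and> coprime a b \<and>
    (\<forall>p. prime p \<longrightarrow> p dvd a * b * (a + b) \<longrightarrow> p \<in> S)}"

text \<open>Type 2 also covers primes dividing none of \<open>a\<close>, \<open>b\<close>,
  \<open>a + b\<close>; they do no harm because their exponent is 0.\<close>

fun prime_type :: "nat \<times> nat \<Rightarrow> nat \<Rightarrow> nat" where
  "prime_type (a, b) p = (if p dvd a then 0 else if p dvd b then 1 else 2)"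

text \<open>Each prime divides at most one of the pairwise coprime \<open>a\<close>,
  \<open>b\<close>, \<open>a + b\<close>, so this single exponent and the type together recover all
  three multiplicities.\<close>

fun expo :: "nat \<times> nat \<Rightarrow> nat \<Rightarrow> nat" where
  "expo (a, b) p = multiplicity p (a * b * (a + b))"

lemma prod_prime_powers_eq:
  fixes n :: nat
  assumes "finite T" "0 < n" "\<And>p. p \<in> T \<Longrightarrow> prime p" "\<And>p. prime p \<Longrightarrow> p dvd n \<Longrightarrow> p \<in> T"
  shows "(\<Prod>p\<in>T. p ^ multiplicity p n) = n"
proof -
  have "n = (\<Prod>p\<in>prime_factors n. p ^ multiplicity p n)"
    using assms(2) by (rule prime_factorization_nat)
  also have "\<dots> = (\<Prod>p\<in>T. p ^ multiplicity p n)"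
    using assms by (intro prod.mono_neutral_left)
      (auto simp: prime_factors_dvd not_dvd_imp_multiplicity_0)
  finally show ?thesis by simp
qed

lemma coprime_sums_factorization:
  assumes S: "finite S" "\<And>p. p \<in> S \<Longrightarrow> prime p" and u: "(a, b) \<in> coprime_sums S"
  shows "(\<Prod>p\<in>{p \<in> S. prime_type (a, b) p = 0}. p ^ expo (a, b) p) = a"
    and "(\<Prod>p\<in>{p \<in> S. prime_type (a, b) p = 1}. p ^ expo (a, b) p) = b"
    and "(\<Prod>p\<in>{p \<in> S. prime_type (a, b) p = 2}. p ^ expo (a, b) p) = a + b"
    and "(\<Prod>p\<in>S. p ^ expo (a, b) p) = a * b * (a + b)"
proof -
  from u have ab: "0 < a" "0 < b" "coprime a b"
    and sm: "\<And>p. prime p \<Longrightarrow> p dvd a * b * (a + b) \<Longrightarrow> p \<in> S"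
    by (auto simp: coprime_sums_def)
  have disj: "\<not> p dvd b" "\<not> p dvd a + b" if "prime p" "p dvd a" for p
    using that ab by (metis coprime_common_divisor_nat not_prime_1 dvd_add_right_iff)+
  have disj': "\<not> p dvd a + b" if "prime p" "p dvd b" for p
    using that ab by (metis dvd_add_left_iff disj(1))
  have ex: "expo (a, b) p = multiplicity p a + multiplicity p b + multiplicity p (a + b)" if "p \<in> S" for p
    using S(2)[OF that] ab by (simp add: prime_elem_multiplicity_mult_distrib)
  have "(\<Prod>p\<in>{p \<in> S. prime_type (a, b) p = 0}. p ^ expo (a, b) p) =
      (\<Prod>p\<in>{p \<in> S. prime_type (a, b) p = 0}. p ^ multiplicity p a)"
    by (intro prod.cong refl)
      (use S disj in \<open>auto simp: ex not_dvd_imp_multiplicity_0 simp del: expo.simps split: if_splits\<close>)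
  also have "\<dots> = a"
    using S ab sm by (intro prod_prime_powers_eq) auto
  finally show "(\<Prod>p\<in>{p \<in> S. prime_type (a, b) p = 0}. p ^ expo (a, b) p) = a" .
  have "(\<Prod>p\<in>{p \<in> S. prime_type (a, b) p = 1}. p ^ expo (a, b) p) =
      (\<Prod>p\<in>{p \<in> S. prime_type (a, b) p = 1}. p ^ multiplicity p b)"
    by (intro prod.cong refl)
      (use S disj' in \<open>auto simp: ex not_dvd_imp_multiplicity_0 simp del: expo.simps split: if_splits\<close>)
  also have "\<dots> = b"
    using S ab sm disj by (intro prod_prime_powers_eq) auto
  finally show "(\<Prod>p\<in>{p \<in> S. prime_type (a, b) p = 1}. p ^ expo (a, b) p) = b" .
  have "(\<Prod>p\<in>{p \<in> S. prime_type (a, b) p = 2}. p ^ expo (a, b) p) =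
      (\<Prod>p\<in>{p \<in> S. prime_type (a, b) p = 2}. p ^ multiplicity p (a + b))"
    by (intro prod.cong refl)
      (use S in \<open>auto simp: ex not_dvd_imp_multiplicity_0 simp del: expo.simps split: if_splits\<close>)
  also have "\<dots> = a + b"
    using S ab sm disj disj' by (intro prod_prime_powers_eq) auto
  finally show "(\<Prod>p\<in>{p \<in> S. prime_type (a, b) p = 2}. p ^ expo (a, b) p) = a + b" .
  show "(\<Prod>p\<in>S. p ^ expo (a, b) p) = a * b * (a + b)"
    unfolding expo.simps using S ab sm by (intro prod_prime_powers_eq) auto
qed

text \<open>The truncated differences are the positive and negative parts of
  \<open>f p - m * e p\<close>. The last product is a denominator common to all choices of
  \<open>P\<close>, hence to all three coordinates of a solution. The core is
  \<open>m * e p + (f p - m * e p) = f p + (m * e p - f p)\<close>.\<close>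

lemma prod_powers_quotient:
  fixes e f :: "nat \<Rightarrow> nat"
  assumes "finite S" "P \<subseteq> S"
  shows "(\<Prod>p\<in>P. p ^ e p) ^ m * ((\<Prod>p\<in>P. p ^ (f p - m * e p)) * (\<Prod>p\<in>S - P. p ^ (m * e p - f p))) =
    (\<Prod>p\<in>P. p ^ f p) * (\<Prod>p\<in>S. p ^ (m * e p - f p))"
proof -
  have "(\<Prod>p\<in>P. p ^ e p) ^ m * (\<Prod>p\<in>P. p ^ (f p - m * e p)) =
      (\<Prod>p\<in>P. p ^ (m * e p + (f p - m * e p)))"
    by (simp add: prod_power_distrib power_add prod.distrib mult.commute flip: power_mult)
  also have "\<dots> = (\<Prod>p\<in>P. p ^ (f p + (m * e p - f p)))"
    by (intro prod.cong refl arg_cong2[where f = "(^)"]) linarith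
  also have "\<dots> = (\<Prod>p\<in>P. p ^ f p) * (\<Prod>p\<in>P. p ^ (m * e p - f p))"
    by (simp add: power_add prod.distrib)
  finally show ?thesis
    using prod.subset_diff[OF assms(2,1), of "\<lambda>p. p ^ (m * e p - f p)"]
    by (simp add: algebra_simps)
qed

lemma prod_powers_quotient_le:
  fixes e f :: "nat \<Rightarrow> nat"
  assumes "finite S" "P \<subseteq> S" "\<And>p. p \<in> S \<Longrightarrow> 0 < p"
  shows "(\<Prod>p\<in>P. p ^ (f p - m * e p)) * (\<Prod>p\<in>S - P. p ^ (m * e p - f p)) \<le>
    (\<Prod>p\<in>S. p ^ ((f p - m * e p) + (m * e p - f p)))"
proof -
  have "(\<Prod>p\<in>P. p ^ (f p - m * e p)) * (\<Prod>p\<in>S - P. p ^ (m * e p - f p)) \<le>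
    (\<Prod>p\<in>P. p ^ ((f p - m * e p) + (m * e p - f p))) * (\<Prod>p\<in>S - P. p ^ ((f p - m * e p) + (m * e p - f p)))"
    by (intro mult_mono prod_mono conjI power_increasing) (use assms in \<open>force simp: Suc_le_eq\<close>)+
  also have "\<dots> = (\<Prod>p\<in>S. p ^ ((f p - m * e p) + (m * e p - f p)))"
    by (subst prod.subset_diff[OF assms(2,1)]) (rule mult.commute)
  finally show ?thesis .
qed

text \<open>Equal types keep the quotients v_i / u_i^m, after clearing their common denominator D,
  as small as the distance between the exponent vectors of v and u^m allows.\<close>

lemma coprime_sums_quotient:
  assumes S: "finite S" "\<And>p. p \<in> S \<Longrightarrow> prime p"
    and u: "(a, b) \<in> coprime_sums S" and v: "(a', b') \<in> coprime_sums S"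
    and ty: "\<And>p. p \<in> S \<Longrightarrow> prime_type (a, b) p = prime_type (a', b') p"
  obtains t1 t2 t3 D where "0 < D" "a ^ m * t1 = a' * D" "b ^ m * t2 = b' * D"
    "(a + b) ^ m * t3 = (a' + b') * D" "0 < t1" "0 < t2"
    "t1 \<le> (\<Prod>p\<in>S. p ^ ((expo (a', b') p - m * expo (a, b) p) + (m * expo (a, b) p - expo (a', b') p)))"
    "t2 \<le> (\<Prod>p\<in>S. p ^ ((expo (a', b') p - m * expo (a, b) p) + (m * expo (a, b) p - expo (a', b') p)))"
proof -
  let ?e = "expo (a, b)" and ?f = "expo (a', b')"
  define P where "P i = {p \<in> S. prime_type (a, b) p = i}" for i
  have P': "P i = {p \<in> S. prime_type (a', b') p = i}" for i
    using ty by (auto simp: P_def simp del: prime_type.simps)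
  have PS: "P i \<subseteq> S" for i by (auto simp: P_def)
  have pos: "0 < p" if "p \<in> S" for p using S(2)[OF that] by (rule prime_gt_0_nat)
  define t where "t i = (\<Prod>p\<in>P i. p ^ (?f p - m * ?e p)) * (\<Prod>p\<in>S - P i. p ^ (m * ?e p - ?f p))" for i
  define D where "D = (\<Prod>p\<in>S. p ^ (m * ?e p - ?f p))"
  have q: "(\<Prod>p\<in>P i. p ^ ?e p) ^ m * t i = (\<Prod>p\<in>P i. p ^ ?f p) * D" for i
    unfolding t_def D_def by (rule prod_powers_quotient[OF S(1) PS])
  have le: "t i \<le> (\<Prod>p\<in>S. p ^ ((?f p - m * ?e p) + (m * ?e p - ?f p)))" for i
    unfolding t_def by (rule prod_powers_quotient_le[OF S(1) PS pos])
  have tpos: "0 < t i" for i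
    unfolding t_def using pos PS[of i] by (auto intro!: prod_pos simp del: expo.simps)
  have Dpos: "0 < D"
    unfolding D_def using pos by (auto intro!: prod_pos simp del: expo.simps)
  have fu: "(\<Prod>p\<in>P 0. p ^ ?e p) = a" "(\<Prod>p\<in>P 1. p ^ ?e p) = b" "(\<Prod>p\<in>P 2. p ^ ?e p) = a + b"
    using coprime_sums_factorization(1,2,3)[OF S u] unfolding P_def by simp_all
  have fv: "(\<Prod>p\<in>P 0. p ^ ?f p) = a'" "(\<Prod>p\<in>P 1. p ^ ?f p) = b'" "(\<Prod>p\<in>P 2. p ^ ?f p) = a' + b'"
    using coprime_sums_factorization(1,2,3)[OF S v] unfolding P' by simp_all
  show ?thesis
    using that[OF Dpos q[of 0, unfolded fu fv] q[of 1, unfolded fu fv] q[of 2, unfolded fu fv]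
      tpos tpos le le] .
qed

section \<open>Repulsion and gaps in logarithmic form\<close>

definition weight :: "nat \<times> nat \<Rightarrow> nat \<Rightarrow> real" where
  "weight u p = real (expo u p) * ln (real p)"

text \<open>One of the two truncated differences is 0 and the other is the absolute difference. The
  bound on the cleared quotients thus becomes an l1 distance between weight vectors.\<close>

lemma ln_prod_powers_dist:
  assumes "finite S" "\<And>p. p \<in> S \<Longrightarrow> prime p"
  shows "ln (real (\<Prod>p\<in>S. p ^ ((expo v p - m * expo u p) + (m * expo u p - expo v p)))) =
    (\<Sum>p\<in>S. \<bar>weight v p - real m * weight u p\<bar>)"
proof -
  have "ln (real (\<Prod>p\<in>S. p ^ ((expo v p - m * expo u p) + (m * expo u p - expo v p)))) =
      (\<Sum>p\<in>S. ln (real p ^ ((expo v p - m * expo u p) + (m * expo u p - expo v p))))"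
    unfolding of_nat_prod of_nat_power using assms
    by (intro ln_prod) (auto dest: prime_gt_0_nat)
  also have "\<dots> = (\<Sum>p\<in>S. \<bar>weight v p - real m * weight u p\<bar>)"
  proof (intro sum.cong refl)
    fix p assume "p \<in> S"
    then have "1 \<le> p" using assms(2) by (metis prime_ge_1_nat)
    then have "0 \<le> ln (real p)" by simp
    have "real ((expo v p - m * expo u p) + (m * expo u p - expo v p)) =
        \<bar>real (expo v p) - real m * real (expo u p)\<bar>"
      by (cases "expo v p \<le> m * expo u p") (auto simp: of_nat_diff simp flip: of_nat_mult)
    then have "ln (real p ^ ((expo v p - m * expo u p) + (m * expo u p - expo v p))) =
        \<bar>real (expo v p) - real m * real (expo u p)\<bar> * \<bar>ln (real p)\<bar>"
      using \<open>1 \<le> p\<close> \<open>0 \<le> ln (real p)\<close> by (simp add: ln_realpow del: of_nat_add)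
    also have "\<dots> = \<bar>weight v p - real m * weight u p\<bar>"
      unfolding abs_mult[symmetric] by (simp add: weight_def algebra_simps)
    finally show "ln (real p ^ ((expo v p - m * expo u p) + (m * expo u p - expo v p))) =
        \<bar>weight v p - real m * weight u p\<bar>" .
  qed
  finally show ?thesis .
qed

text \<open>With \<open>m = 2 * N + 1\<close>, the equation for \<open>v\<close>, multiplied by
  \<open>D\<close>, is a relation between the \<open>m\<close>-th powers of \<open>a\<close>,
  \<open>b\<close>, \<open>a + b\<close> with coefficients \<open>t1\<close>, \<open>t2\<close>,
  \<open>t3\<close>. The claim is the logarithm of \<open>thue_bound\<close> for it.\<close>

lemma coprime_sums_repulsion:
  assumes S: "finite S" "\<And>p. p \<in> S \<Longrightarrow> prime p"
    and u: "(a, b) \<in> coprime_sums S" and v: "(a', b') \<in> coprime_sums S"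
    and ty: "\<And>p. p \<in> S \<Longrightarrow> prime_type (a, b) p = prime_type (a', b') p"
    and "odd N"
  shows "real (N + 1) * ln (real (a + b)) \<le>
    real (5 * N + 2) * ln 2 + (\<Sum>p\<in>S. \<bar>weight (a', b') p - real (2 * N + 1) * weight (a, b) p\<bar>)"
proof -
  let ?T = "\<Prod>p\<in>S. p ^ ((expo (a', b') p - (2 * N + 1) * expo (a, b) p) +
      ((2 * N + 1) * expo (a, b) p - expo (a', b') p))"
  obtain t1 t2 t3 D where t: "0 < D" "a ^ (2 * N + 1) * t1 = a' * D" "b ^ (2 * N + 1) * t2 = b' * D"
    "(a + b) ^ (2 * N + 1) * t3 = (a' + b') * D" "0 < t1" "0 < t2" "t1 \<le> ?T" "t2 \<le> ?T"
    by (rule coprime_sums_quotient[OF S u v ty, where m = "2 * N + 1"])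
  have ab: "0 < a" "0 < b" "coprime a b" using u by (auto simp: coprime_sums_def)
  have "a ^ (2 * N + 1) * t1 + b ^ (2 * N + 1) * t2 = (a + b) ^ (2 * N + 1) * t3"
    unfolding t by (simp add: algebra_simps)
  then have "int (a ^ (2 * N + 1) * t1 + b ^ (2 * N + 1) * t2) = int ((a + b) ^ (2 * N + 1) * t3)"
    by (rule arg_cong)
  then have eq: "int a ^ (2 * N + 1) * int t1 + int b ^ (2 * N + 1) * int t2 =
      (int a + int b) ^ (2 * N + 1) * int t3"
    by (simp only: of_nat_mult of_nat_add of_nat_power)
  have "(int a + int b) ^ (N + 1) \<le> 2 ^ (5 * N + 2) * int ?T"
    using ab t(5-8) by (intro thue_bound[of "int a" "int b" N "int t1" "int ?T" "int t2" "int t3"] \<open>odd N\<close> eq)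
      (simp_all only: of_nat_le_iff of_nat_0_less_iff coprime_int_iff)
  then have le: "real (a + b) ^ (N + 1) \<le> 2 ^ (5 * N + 2) * real ?T"
    by (metis (mono_tags, lifting) of_nat_add of_nat_le_iff of_nat_mult of_nat_numeral of_nat_power)
  have pos: "0 < real (a + b) ^ (N + 1)" using ab by simp
  have Tpos: "0 < real ?T" using t by linarith
  have "real (N + 1) * ln (real (a + b)) = ln (real (a + b) ^ (N + 1))"
    using ab by (subst ln_realpow) simp_all
  also have "\<dots> \<le> ln (2 ^ (5 * N + 2) * real ?T)"
    by (rule iffD2[OF ln_le_cancel_iff[OF pos less_le_trans[OF pos le]] le])
  also have "\<dots> = real (5 * N + 2) * ln 2 + ln (real ?T)"
    using Tpos by (subst ln_mult_pos) (simp_all only: ln_realpow zero_less_power zero_less_numeral)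
  also have "ln (real ?T) = (\<Sum>p\<in>S. \<bar>weight (a', b') p - real (2 * N + 1) * weight (a, b) p\<bar>)"
    by (rule ln_prod_powers_dist[OF S])
  finally show ?thesis .
qed

text \<open>Here the comparison is with \<open>a + b = c\<close> itself: eliminating
  \<open>a\<close> shows that \<open>c\<close> divides \<open>t2 - t1\<close>. Equality
  \<open>t1 = t2\<close> would make the two pairs proportional, hence equal by coprimality.\<close>

lemma coprime_sums_gap:
  assumes S: "finite S" "\<And>p. p \<in> S \<Longrightarrow> prime p"
    and u: "(a, b) \<in> coprime_sums S" and v: "(a', b') \<in> coprime_sums S"
    and ty: "\<And>p. p \<in> S \<Longrightarrow> prime_type (a, b) p = prime_type (a', b') p"
    and "(a', b') \<noteq> (a, b)"
  shows "ln (real (a + b)) \<le> (\<Sum>p\<in>S. \<bar>weight (a', b') p - weight (a, b) p\<bar>)"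
proof -
  let ?T = "\<Prod>p\<in>S. p ^ ((expo (a', b') p - 1 * expo (a, b) p) + (1 * expo (a, b) p - expo (a', b') p))"
  obtain t1 t2 t3 D where t: "0 < D" "a ^ 1 * t1 = a' * D" "b ^ 1 * t2 = b' * D"
    "(a + b) ^ 1 * t3 = (a' + b') * D" "0 < t1" "0 < t2" "t1 \<le> ?T" "t2 \<le> ?T"
    by (rule coprime_sums_quotient[OF S u v ty, where m = 1])
  have ab: "0 < a" "0 < b" "coprime a b" using u by (auto simp: coprime_sums_def)
  have ab': "0 < a'" "0 < b'" "coprime a' b'" using v by (auto simp: coprime_sums_def)
  have "t1 \<noteq> t2"
  proof
    assume "t1 = t2"
    then have "(a * b') * (D * t1) = (a' * b) * (D * t1)" 
      using t by (metis (no_types, opaque_lifting) mult.assoc mult.commute power_one_right)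
    then have "a * b' = a' * b" using t by simp
    then have "a = a' \<and> b = b'"
      using ab ab' by (metis coprime_commute coprime_crossproduct_nat mult.commute)
    then show False using \<open>(a', b') \<noteq> (a, b)\<close> by simp
  qed
  have "int a * int t1 + int b * int t2 = (int a + int b) * int t3"
    using t(2-4) by (simp add: algebra_simps flip: of_nat_mult of_nat_add)
  then have "int b * (int t2 - int t1) = (int a + int b) * (int t3 - int t1)"
    by (simp add: algebra_simps)
  then have "int a + int b dvd int b * (int t2 - int t1)" by simp
  moreover have "coprime (int a + int b) (int b)"
    using ab unfolding coprime_iff_gcd_eq_1 by (simp flip: coprime_iff_gcd_eq_1)
  ultimately have "int a + int b dvd int t2 - int t1"
    by (simp add: coprime_dvd_mult_right_iff)
  then have "int a + int b \<le> \<bar>int t2 - int t1\<bar>"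
    using \<open>t1 \<noteq> t2\<close> dvd_imp_le_int[of "int t2 - int t1" "int a + int b"] by simp
  also have "\<dots> \<le> int ?T" using t(7,8) by linarith
  finally have "ln (real (a + b)) \<le> ln (real ?T)"
    using ab by (subst ln_le_cancel_iff) (linarith+)
  also have "\<dots> = (\<Sum>p\<in>S. \<bar>weight (a', b') p - real 1 * weight (a, b) p\<bar>)"
    by (rule ln_prod_powers_dist[OF S])
  finally show ?thesis by simp
qed

section \<open>Sizes and cells\<close>

text \<open>The size of a solution. It is preferred to the logarithm of \<open>a + b\<close> because
  the weights sum to it exactly, so dividing by it normalises the weight vector; the price is the
  factor 3 in \<open>log_product_bounds\<close>.\<close>

definition log_product :: "nat \<times> nat \<Rightarrow> real" where
  "log_product u = ln (real (fst u * snd u * (fst u + snd u)))"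

lemma log_product_bounds:
  assumes "(a, b) \<in> coprime_sums S"
  shows "ln 2 \<le> log_product (a, b)" "log_product (a, b) \<le> 3 * ln (real (a + b))"
proof -
  have ab: "0 < a" "0 < b" using assms by (auto simp: coprime_sums_def)
  have "1 * 2 \<le> a * b * (a + b)" using ab by (intro mult_le_mono) (auto simp: Suc_le_eq)
  then show "ln 2 \<le> log_product (a, b)"
    unfolding log_product_def fst_conv snd_conv by (subst ln_le_cancel_iff) linarith+
  have "a * b * (a + b) \<le> (a + b) * (a + b) * (a + b)" by (intro mult_le_mono) auto
  also have "\<dots> = (a + b) ^ 3" by (simp add: power3_eq_cube)
  finally have "ln (real (a * b * (a + b))) \<le> ln (real ((a + b) ^ 3))"
    using ab by (subst ln_le_cancel_iff) (simp_all only: of_nat_le_iff of_nat_0_less_iff, simp_all)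
  also have "\<dots> = 3 * ln (real (a + b))"
    unfolding of_nat_power using ab by (subst ln_realpow) simp_all
  finally show "log_product (a, b) \<le> 3 * ln (real (a + b))" by (simp add: log_product_def)
qed

lemma log_product_pos:
  assumes "u \<in> coprime_sums S"
  shows "0 < log_product u"
proof -
  have "0 < ln (2 :: real)" by simp
  also have "\<dots> \<le> log_product u"
    using log_product_bounds(1)[of "fst u" "snd u" S] assms by simp
  finally show ?thesis .
qed

lemma sum_weight:
  assumes S: "finite S" "\<And>p. p \<in> S \<Longrightarrow> prime p" and u: "u \<in> coprime_sums S"
  shows "(\<Sum>p\<in>S. weight u p) = log_product u"
proof -
  obtain a b where ab: "u = (a, b)" by fastforce
  have "log_product u = ln (real (\<Prod>p\<in>S. p ^ expo u p))"
    using coprime_sums_factorization(4)[OF S u[unfolded ab]]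
    by (simp only: ab log_product_def fst_conv snd_conv)
  also have "\<dots> = (\<Sum>p\<in>S. ln (real p ^ expo u p))"
    unfolding of_nat_prod of_nat_power using S by (intro ln_prod) (auto dest: prime_gt_0_nat)
  also have "\<dots> = (\<Sum>p\<in>S. weight u p)"
    using S by (intro sum.cong refl) (auto simp: weight_def ln_realpow dest: prime_gt_0_nat)
  finally show ?thesis by simp
qed

lemma weight_nonneg: "prime p \<Longrightarrow> 0 \<le> weight u p"
  by (auto simp: weight_def dest: prime_ge_1_nat)

text \<open>Index, in direction \<open>p\<close>, of the cube of side \<open>1 / K\<close>
  containing the normalised weight vector.\<close>

definition cell :: "nat \<Rightarrow> nat \<times> nat \<Rightarrow> nat \<Rightarrow> nat" where
  "cell K u p = nat \<lfloor>real K * (weight u p / log_product u)\<rfloor>"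

lemma cell_le:
  assumes S: "finite S" "\<And>p. p \<in> S \<Longrightarrow> prime p" and u: "u \<in> coprime_sums S" and p: "p \<in> S"
  shows "cell K u p \<le> K"
proof -
  have pos: "0 < log_product u"
    using u by (rule log_product_pos)
  have "weight u p \<le> (\<Sum>p\<in>S. weight u p)"
    by (rule member_le_sum[OF p _ S(1)]) (auto intro: weight_nonneg S)
  then have "weight u p / log_product u \<le> 1"
    using pos by (simp add: sum_weight[OF S u])
  then have "real K * (weight u p / log_product u) \<le> real K * 1"
    by (intro mult_left_mono) auto
  then have "\<lfloor>real K * (weight u p / log_product u)\<rfloor> \<le> int K" by linarith
  then show ?thesis by (simp add: cell_def)
qed

text \<open>Scaling \<open>u\<close> by the ratio \<open>r\<close> of the sizes brings each weight
  within \<open>log_product v / (k * card S)\<close> of that of \<open>v\<close>, and summing over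
  \<open>S\<close> removes \<open>card S\<close>. Replacing \<open>r\<close> by \<open>m\<close>
  costs \<open>\<bar>r - m\<bar>\<close> times the total weight of \<open>u\<close>.\<close>

lemma weight_dist_same_cell:
  assumes S: "finite S" "\<And>p. p \<in> S \<Longrightarrow> prime p" and "S \<noteq> {}" and "0 < k"
    and u: "u \<in> coprime_sums S" and v: "v \<in> coprime_sums S"
    and cell: "\<And>p. p \<in> S \<Longrightarrow> cell (k * card S) u p = cell (k * card S) v p"
  shows "(\<Sum>p\<in>S. \<bar>weight v p - m * weight u p\<bar>) \<le>
    log_product v / real k + \<bar>log_product v - m * log_product u\<bar>"
proof -
  let ?K = "real (k * card S)"
  have K: "0 < ?K" using assms by (simp add: card_gt_0_iff)
  have pos: "0 < log_product u" "0 < log_product v"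
    using u v by (auto intro: log_product_pos)
  define r where "r = log_product v / log_product u"
  have 1: "\<bar>weight v p - r * weight u p\<bar> \<le> log_product v / ?K" if p: "p \<in> S" for p
  proof -
    define x where "x = ?K * (weight v p / log_product v)"
    define y where "y = ?K * (weight u p / log_product u)"
    have "0 \<le> x" "0 \<le> y"
      using pos weight_nonneg[OF S(2)[OF p]] by (auto simp: x_def y_def)
    moreover have "nat \<lfloor>x\<rfloor> = nat \<lfloor>y\<rfloor>"
      using cell[OF p] by (simp add: cell_def x_def y_def)
    ultimately have "\<lfloor>x\<rfloor> = \<lfloor>y\<rfloor>" by (simp add: eq_nat_nat_iff)
    then have "\<bar>x - y\<bar> \<le> 1" by linarith
    have "weight v p = log_product v / ?K * x" "r * weight u p = log_product v / ?K * y"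
      using pos K by (simp_all add: x_def y_def r_def del: of_nat_mult)
    then have "weight v p - r * weight u p = (log_product v / ?K) * (x - y)"
      by (simp only: right_diff_distrib)
    then have "\<bar>weight v p - r * weight u p\<bar> = (log_product v / ?K) * \<bar>x - y\<bar>"
      using pos K by (simp add: abs_mult)
    also have "\<dots> \<le> (log_product v / ?K) * 1"
      using \<open>\<bar>x - y\<bar> \<le> 1\<close> pos K by (intro mult_left_mono) auto
    finally show ?thesis by simp
  qed
  have "(\<Sum>p\<in>S. \<bar>weight v p - m * weight u p\<bar>) \<le>
      (\<Sum>p\<in>S. log_product v / ?K + \<bar>r - m\<bar> * weight u p)"
  proof (rule sum_mono)
    fix p assume p: "p \<in> S"
    have "weight v p - m * weight u p = (weight v p - r * weight u p) + (r - m) * weight u p"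
      by (simp add: algebra_simps)
    then have "\<bar>weight v p - m * weight u p\<bar> \<le>
        \<bar>weight v p - r * weight u p\<bar> + \<bar>(r - m) * weight u p\<bar>"
      by simp
    then show "\<bar>weight v p - m * weight u p\<bar> \<le> log_product v / ?K + \<bar>r - m\<bar> * weight u p"
      using 1[OF p] weight_nonneg[OF S(2)[OF p], of u] by (simp add: abs_mult)
  qed
  also have "\<dots> = log_product v / real k + \<bar>r - m\<bar> * log_product u"
    using assms by (simp add: sum.distrib sum_weight[OF S u] flip: sum_distrib_left)
  also have "\<bar>r - m\<bar> * log_product u = \<bar>(r - m) * log_product u\<bar>"
    using pos by (simp add: abs_mult)
  also have "(r - m) * log_product u = log_product v - m * log_product u"
    using pos by (simp add: r_def field_simps)
  finally show ?thesis .
qed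

section \<open>Counting solutions in one cell\<close>

text \<open>Induction on \<open>n\<close>, peeling off the top range from \<open>l * q ^ n\<close>
  to \<open>l * q ^ Suc n\<close>: two members there would have ratio below \<open>q\<close>, so it
  holds at most one.\<close>

lemma card_le_of_geometric_gaps:
  fixes L :: "'a \<Rightarrow> real"
  assumes "\<And>x. x \<in> A \<Longrightarrow> l \<le> L x \<and> L x < l * q ^ n" "0 \<le> q"
    and "\<And>x y. x \<in> A \<Longrightarrow> y \<in> A \<Longrightarrow> x \<noteq> y \<Longrightarrow> L x \<le> L y \<Longrightarrow> q * L x \<le> L y"
  shows "finite A \<and> card A \<le> n"
  using assms(1,3)
proof (induction n arbitrary: A)
  case 0
  then have "A = {}" by fastforce
  then show ?case by simp
next
  case (Suc n)
  define B where "B = {x \<in> A. L x < l * q ^ n}"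
  have B: "finite B \<and> card B \<le> n"
    by (rule Suc.IH) (use Suc.prems in \<open>auto simp: B_def\<close>)
  have "x = y" if "x \<in> A - B" "y \<in> A - B" "L x \<le> L y" for x y
  proof (rule ccontr)
    assume "x \<noteq> y"
    then have "q * L x \<le> L y" using Suc.prems(2) that by simp
    moreover have "q * (l * q ^ n) \<le> q * L x"
      using that \<open>0 \<le> q\<close> by (intro mult_left_mono) (auto simp: B_def)
    moreover have "L y < l * q ^ Suc n" using Suc.prems(1) that by simp
    ultimately show False by (simp add: mult.left_commute)
  qed
  then have "x = y" if "x \<in> A - B" "y \<in> A - B" for x y
    using that by (metis linear)
  then have AB: "A - B = {} \<or> (\<exists>x. A - B = {x})" by blast
  have fin: "finite (A - B)" "card (A - B) \<le> 1"
    using AB by (elim disjE exE; simp only: finite.emptyI finite.insertI card.empty; simp)+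
  have "B \<union> (A - B) = A" by (auto simp: B_def)
  moreover have "finite (B \<union> (A - B))" "card (B \<union> (A - B)) \<le> Suc n"
    using B fin card_Un_le[of B "A - B"] by simp_all
  ultimately show ?case by (simp only:)
qed

text \<open>Consecutive sizes grow by a factor \<open>5 / 4\<close>. Sizes from \<open>ln 2\<close>
  up to \<open>50 * ln 2\<close> allow 18 solutions since \<open>(5 / 4) ^ 18 > 50\<close>; larger
  ones lie within a factor 44 of the least of them and allow 17 since
  \<open>(5 / 4) ^ 17 > 44\<close>.\<close>

lemma card_coprime_sums_cell:
  assumes S: "finite S" "\<And>p. p \<in> S \<Longrightarrow> prime p" and "S \<noteq> {}"
  shows "finite {u \<in> coprime_sums S.
      (\<forall>p\<in>S. prime_type u p = \<tau> p) \<and> (\<forall>p\<in>S. cell (15 * card S) u p = \<kappa> p)} \<and>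
    card {u \<in> coprime_sums S.
      (\<forall>p\<in>S. prime_type u p = \<tau> p) \<and> (\<forall>p\<in>S. cell (15 * card S) u p = \<kappa> p)} \<le> 35"
    (is "finite ?A \<and> card ?A \<le> 35")
proof -
  let ?L = log_product
  have Lb: "ln 2 \<le> ?L u" "0 < ?L u" if "u \<in> ?A" for u
    using log_product_bounds(1)[of "fst u" "snd u" S] log_product_pos[of u S] that by auto
  have dist: "(\<Sum>p\<in>S. \<bar>weight v p - m * weight u p\<bar>) \<le> ?L v / 15 + \<bar>?L v - m * ?L u\<bar>"
    if "u \<in> ?A" "v \<in> ?A" for u v m
    using weight_dist_same_cell[OF S \<open>S \<noteq> {}\<close>, of 15 u v m] that by auto
  have gap: "5 / 4 * ?L u \<le> ?L v" if uv: "u \<in> ?A" "v \<in> ?A" "u \<noteq> v" "?L u \<le> ?L v" for u v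
  proof -
    obtain a b a' b' where eq: "u = (a, b)" "v = (a', b')" by fastforce
    have "?L u / 3 \<le> ln (real (a + b))"
      using log_product_bounds(2)[of a b S] uv(1) by (simp add: eq)
    also have "\<dots> \<le> (\<Sum>p\<in>S. \<bar>weight v p - weight u p\<bar>)"
      unfolding eq by (rule coprime_sums_gap[OF S]) (use uv eq in auto)
    also have "\<dots> \<le> ?L v / 15 + \<bar>?L v - ?L u\<bar>"
      using dist[OF uv(1,2), of 1] by simp
    \<comment> \<open>The inequality \<open>?L u / 3 \<le> ?L v / 15 + ?L v - ?L u\<close> is
      exactly the claimed factor \<open>5 / 4\<close>.\<close>
    finally show ?thesis using uv(4) by simp
  qed
  have repel: "?L v < 44 * ?L u" if uv: "u \<in> ?A" "v \<in> ?A" "?L u \<le> ?L v" "50 * ln 2 \<le> ?L u" for u v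
  proof -
    obtain a b a' b' where eq: "u = (a, b)" "v = (a', b')" by fastforce
    define \<rho> where "\<rho> = ?L v / ?L u"
    have \<rho>: "1 \<le> \<rho>" "?L v = \<rho> * ?L u" using uv Lb[of u] by (simp_all add: \<rho>_def)
    \<comment> \<open>Only odd \<open>N\<close> are available, so the exponents
      \<open>m = 2 * N + 1\<close> are 3, 7, 11 and so on. This choice makes
      \<open>m = 4 * n + 3\<close> lie within 2 of \<open>\<rho>\<close>.\<close>
    define n where "n = nat \<lfloor>(\<rho> - 1) / 4\<rfloor>"
    have "real n = of_int \<lfloor>(\<rho> - 1) / 4\<rfloor>" using \<rho>(1) by (simp add: n_def)
    then have "real n \<le> (\<rho> - 1) / 4" "(\<rho> - 1) / 4 < real n + 1"
      using floor_correct[of "(\<rho> - 1) / 4"] by simp_all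
    then have n: "4 * real n + 1 \<le> \<rho>" "\<rho> < 4 * real n + 5"
      by simp_all
    define N where "N = 2 * n + 1"
    have "real (N + 1) * (?L u / 3) \<le> real (N + 1) * ln (real (a + b))"
      using log_product_bounds(2)[of a b S] uv(1) by (intro mult_left_mono) (simp_all add: eq)
    also have "\<dots> \<le> real (5 * N + 2) * ln 2 + (\<Sum>p\<in>S. \<bar>weight v p - real (2 * N + 1) * weight u p\<bar>)"
      unfolding eq by (rule coprime_sums_repulsion[OF S]) (use uv eq in \<open>auto simp: N_def\<close>)
    \<comment> \<open>The threshold 50 enters here: it turns the constants of the Pade polynomials
      into about \<open>N / 10\<close> times \<open>?L u\<close>, against the gain of
      \<open>N / 3\<close>.\<close>
    also have "\<dots> \<le> real (5 * N + 2) * (?L u / 50) + (?L v / 15 + \<bar>?L v - real (2 * N + 1) * ?L u\<bar>)"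
      using uv(4) by (intro add_mono mult_left_mono dist uv(1,2)) auto
    also have "\<bar>?L v - real (2 * N + 1) * ?L u\<bar> = \<bar>\<rho> - real (2 * N + 1)\<bar> * ?L u"
      unfolding \<rho>(2) left_diff_distrib[symmetric] using Lb(2)[OF uv(1)] by (simp add: abs_mult)
    also have "\<dots> \<le> 2 * ?L u"
      using n Lb(2)[OF uv(1)] by (intro mult_right_mono) (auto simp: N_def)
    finally have "?L u * (real (N + 1) / 3) \<le> ?L u * (real (5 * N + 2) / 50 + \<rho> / 15 + 2)"
      unfolding \<rho>(2) by (simp add: algebra_simps add_divide_distrib)
    then have "real (N + 1) / 3 \<le> real (5 * N + 2) / 50 + \<rho> / 15 + 2"
      using Lb(2)[OF uv(1)] by simp
    \<comment> \<open>With \<open>n\<close> about \<open>\<rho> / 4\<close> the left side grows like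
      \<open>\<rho> / 6\<close>, the right side only like
      \<open>\<rho> / 20 + \<rho> / 15\<close>.\<close>
    then have "\<rho> < 44" using n by (simp add: N_def add_divide_distrib)
    then show ?thesis unfolding \<rho>(2) using Lb(2)[OF uv(1)] by simp
  qed
  define B where "B = {u \<in> ?A. ?L u < 50 * ln 2}"
  have B: "finite B \<and> card B \<le> 18"
  proof (rule card_le_of_geometric_gaps[where L = ?L and l = "ln 2" and q = "5 / 4"])
    fix u assume "u \<in> B"
    then have "u \<in> ?A" "?L u < 50 * ln 2" by (simp_all add: B_def)
    moreover have "ln 2 * 50 \<le> ln 2 * (5 / 4 :: real) ^ 18"
      by (rule mult_left_mono) (simp_all add: power_divide)
    ultimately show "ln 2 \<le> ?L u \<and> ?L u < ln 2 * (5 / 4) ^ 18"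
      using Lb(1)[of u] by linarith
  qed (use gap in \<open>auto simp: B_def\<close>)
  have C: "finite (?A - B) \<and> card (?A - B) \<le> 17"
  proof (cases "?A - B = {}")
    case True
    then show ?thesis by (simp only: finite.emptyI card.empty) simp
  next
    case False
    then obtain w where "w \<in> ?A - B" by blast
    \<comment> \<open>Minimising the integer \<open>a * b * (a + b)\<close> instead of its logarithm
      gives a least element before finiteness is known.\<close>
    then obtain u where u: "u \<in> ?A - B"
      and least: "\<And>v. v \<in> ?A - B \<Longrightarrow> fst u * snd u * (fst u + snd u) \<le> fst v * snd v * (fst v + snd v)"
      using ex_has_least_nat[of "\<lambda>u. u \<in> ?A - B" w "\<lambda>u. fst u * snd u * (fst u + snd u)"] by blast
    have uA: "u \<in> ?A" and u50: "50 * ln 2 \<le> ?L u" using u by (auto simp: B_def)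
    have upos: "0 < fst u * snd u * (fst u + snd u)" using uA by (auto simp: coprime_sums_def)
    show ?thesis
    proof (rule card_le_of_geometric_gaps[where L = ?L and l = "?L u" and q = "5 / 4"])
      fix v assume v: "v \<in> ?A - B"
      then have vA: "v \<in> ?A" by simp
      have "?L u \<le> ?L v"
        using least[OF v] upos unfolding log_product_def
        by (subst ln_le_cancel_iff) linarith+
      moreover have "?L u * 44 \<le> ?L u * (5 / 4) ^ 17"
        by (rule mult_left_mono) (use Lb(2)[OF uA] in \<open>simp_all add: power_divide\<close>)
      ultimately show "?L u \<le> ?L v \<and> ?L v < ?L u * (5 / 4) ^ 17"
        using repel[OF uA vA _ u50] by linarith
    next
      fix x y assume xy: "x \<in> ?A - B" "y \<in> ?A - B" "x \<noteq> y" "?L x \<le> ?L y"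
      then show "5 / 4 * ?L x \<le> ?L y" by (intro gap) auto
    qed simp
  qed
  have "B \<union> (?A - B) = ?A" by (auto simp: B_def)
  moreover have "finite (B \<union> (?A - B))" "card (B \<union> (?A - B)) \<le> 35"
    using B C card_Un_le[of B "?A - B"] by simp_all
  ultimately show ?thesis by (simp only:)
qed

section \<open>Counting all cells\<close>

lemma card_le_of_fibers:
  assumes "finite B" "f ` A \<subseteq> B"
    and "\<And>y. y \<in> B \<Longrightarrow> finite {x \<in> A. f x = y} \<and> card {x \<in> A. f x = y} \<le> n"
  shows "finite A \<and> card A \<le> n * card B"
proof -
  have A: "A = (\<Union>y\<in>B. {x \<in> A. f x = y})" using assms(2) by auto
  have "finite (\<Union>y\<in>B. {x \<in> A. f x = y})" using assms by blast
  moreover have "card (\<Union>y\<in>B. {x \<in> A. f x = y}) \<le> (\<Sum>y\<in>B. card {x \<in> A. f x = y})"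
    using assms(1) by (rule card_UN_le)
  moreover have "\<dots> \<le> (\<Sum>y\<in>B. n)" using assms(3) by (intro sum_mono) blast
  ultimately show ?thesis using A by (simp add: mult.commute)
qed

text \<open>Fibres of the map to types and cells have at most 35 elements. There are 3 types per
  prime, and the cell indices run from 0 to \<open>15 * card S\<close>.\<close>

lemma card_coprime_sums:
  assumes S: "finite S" "\<And>p. p \<in> S \<Longrightarrow> prime p" and "S \<noteq> {}"
  shows "finite (coprime_sums S) \<and>
    card (coprime_sums S) \<le> 35 * (3 ^ card S * (15 * card S + 1) ^ card S)"
proof -
  let ?K = "15 * card S"
  let ?f = "\<lambda>u. (restrict (prime_type u) S, restrict (cell ?K u) S)"
  let ?B = "(S \<rightarrow>\<^sub>E {..2::nat}) \<times> (S \<rightarrow>\<^sub>E {..?K})"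
  have "finite (coprime_sums S) \<and> card (coprime_sums S) \<le> 35 * card ?B"
  proof (rule card_le_of_fibers[where f = ?f])
    show "finite ?B" using S by (intro finite_cartesian_product finite_PiE) auto
    have "prime_type u p \<le> 2" for u p by (cases u) simp
    then show "?f ` coprime_sums S \<subseteq> ?B"
      using cell_le[OF S] by (auto simp del: prime_type.simps)
  next
    fix y assume "y \<in> ?B"
    then obtain \<tau> \<kappa> where y: "y = (\<tau>, \<kappa>)" "\<tau> \<in> S \<rightarrow>\<^sub>E {..2}" "\<kappa> \<in> S \<rightarrow>\<^sub>E {..?K}" by blast
    have r: "restrict g S = h \<longleftrightarrow> (\<forall>p\<in>S. g p = h p)" if "h \<in> S \<rightarrow>\<^sub>E X" for g h :: "nat \<Rightarrow> nat" and X
      using that by (fastforce simp: fun_eq_iff restrict_def PiE_def extensional_def)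
    have "{u \<in> coprime_sums S. ?f u = y} =
        {u \<in> coprime_sums S. (\<forall>p\<in>S. prime_type u p = \<tau> p) \<and> (\<forall>p\<in>S. cell ?K u p = \<kappa> p)}"
      unfolding y(1) prod.inject r[OF y(2)] r[OF y(3)] ..
    then show "finite {u \<in> coprime_sums S. ?f u = y} \<and> card {u \<in> coprime_sums S. ?f u = y} \<le> 35"
      using card_coprime_sums_cell[OF S \<open>S \<noteq> {}\<close>, of \<tau> \<kappa>] by (simp only:)
  qed
  then show ?thesis
    using S by (simp add: card_cartesian_product card_PiE)
qed

text \<open>For at most one prime the cell count would exceed the final bound, so this case is
  direct. One of \<open>a\<close>, \<open>b\<close>, \<open>a + b\<close> is even, which puts 2 into
  \<open>S\<close>; then odd divisors of the product are 1.\<close>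

lemma coprime_sums_card_le_1:
  assumes S: "finite S" "\<And>p. p \<in> S \<Longrightarrow> prime p" and "card S \<le> 1"
  shows "coprime_sums S \<subseteq> {(1, 1)}"
proof
  fix u assume "u \<in> coprime_sums S"
  then obtain a b where u: "u = (a, b)" and ab: "0 < a" "0 < b" "coprime a b"
    and sm: "\<And>p. prime p \<Longrightarrow> p dvd a * b * (a + b) \<Longrightarrow> p \<in> S"
    by (auto simp: coprime_sums_def)
  have "even (a * b * (a + b))" by auto
  then have "2 \<in> S" using sm[of 2] by simp
  then have only: "p = 2" if "p \<in> S" for p
    using \<open>card S \<le> 1\<close> \<open>finite S\<close> that by (metis One_nat_def card_le_Suc0_iff_eq)
  have one: "n = 1" if "odd n" "n dvd a * b * (a + b)" for n
  proof (rule ccontr)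
    assume "n \<noteq> 1"
    then obtain p where p: "prime p" "p dvd n" using prime_factor_nat by blast
    then have "p = 2" using only sm that(2) by (meson dvd_trans)
    then show False using p \<open>odd n\<close> by simp
  qed
  have "odd a \<or> odd b"
    using ab(3) coprime_common_divisor[of a b 2] by auto
  moreover have "a dvd a * b * (a + b)" "b dvd a * b * (a + b)" "a + b dvd a * b * (a + b)"
    by auto
  ultimately have "a = 1 \<and> b = 1"
    using one[of a] one[of b] one[of "a + b"] ab by (cases "odd a"; cases "odd b") auto
  then show "u \<in> {(1, 1)}" by (simp add: u)
qed

section \<open>From S-unit points to coprime sums\<close>

text \<open>\<open>S_integers\<close> admits unreduced fractions. If the unit is
  \<open>\<alpha> / \<beta>\<close> with inverse \<open>\<gamma> / \<delta>\<close>, coprimality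
  gives that \<open>d\<close> divides \<open>\<beta>\<close> and \<open>n\<close> divides
  \<open>\<alpha>\<close>, hence \<open>\<beta> * \<delta>\<close>.\<close>

lemma S_units_lowest_terms:
  fixes n d :: int
  assumes "of_int n / of_int d \<in> S_units S" "coprime n d" "d \<noteq> 0" "prime p" "int p dvd n * d"
  shows "p \<in> S"
proof -
  obtain \<alpha> \<beta> \<gamma> \<delta> where eq: "(of_int n :: rat) / of_int d = of_int \<alpha> / of_nat \<beta>"
    and nz: "\<beta> \<noteq> 0" "\<delta> \<noteq> 0"
    and sm: "\<And>p. prime p \<Longrightarrow> p dvd \<beta> \<Longrightarrow> p \<in> S" "\<And>p. prime p \<Longrightarrow> p dvd \<delta> \<Longrightarrow> p \<in> S"
    and inv: "(of_int \<alpha> / of_nat \<beta>) * (of_int \<gamma> / of_nat \<delta>) = (1 :: rat)"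
  proof -
    obtain y where x: "(of_int n :: rat) / of_int d \<in> S_integers S" and y: "y \<in> S_integers S"
      and xy: "of_int n / of_int d * y = 1"
      using assms(1) unfolding S_units_def by blast
    obtain \<alpha> \<beta> where "(of_int n :: rat) / of_int d = of_int \<alpha> / of_nat \<beta>" "\<beta> \<noteq> 0"
      "\<forall>p. prime p \<longrightarrow> p dvd \<beta> \<longrightarrow> p \<in> S"
      using x unfolding S_integers_def by blast
    moreover obtain \<gamma> \<delta> where "y = of_int \<gamma> / of_nat \<delta>" "\<delta> \<noteq> 0"
      "\<forall>p. prime p \<longrightarrow> p dvd \<delta> \<longrightarrow> p \<in> S"
      using y unfolding S_integers_def by blast
    ultimately show ?thesis using that[of \<alpha> \<beta> \<delta> \<gamma>] xy by simp
  qed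
  have "(of_int (n * int \<beta>) :: rat) = of_int (\<alpha> * d)"
    using eq nz \<open>d \<noteq> 0\<close> by (simp add: field_simps)
  then have 1: "n * int \<beta> = \<alpha> * d" by (simp only: of_int_eq_iff)
  have "(of_int (\<alpha> * \<gamma>) :: rat) = of_int (int \<beta> * int \<delta>)"
    using inv nz by (simp add: field_simps)
  then have 2: "\<alpha> * \<gamma> = int \<beta> * int \<delta>" by (simp only: of_int_eq_iff)
  have "d dvd n * int \<beta>" using 1 by simp
  then have d: "d dvd int \<beta>"
    using assms(2) by (simp add: coprime_dvd_mult_right_iff coprime_commute)
  have "n dvd \<alpha> * d" using 1 by (metis dvd_triv_left)
  then have "n dvd \<alpha>" using assms(2) by (simp add: coprime_dvd_mult_left_iff)
  then have n: "n dvd int \<beta> * int \<delta>" using 2 by (metis dvd_mult2)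
  have "prime (int p)" using assms(4) by simp
  then have "int p dvd n \<or> int p dvd d" using assms(5) prime_dvd_mult_iff by blast
  then have "int p dvd int \<beta> * int \<delta>"
    using d n by (meson dvd_mult2 dvd_trans)
  then have "p dvd \<beta> \<or> p dvd \<delta>"
    using \<open>prime p\<close> by (metis int_dvd_int_iff of_nat_mult prime_dvd_mult_iff)
  then show ?thesis using sm \<open>prime p\<close> by blast
qed

text \<open>The points 0 and 1 cut the line into three pieces. With \<open>c = a + b\<close>, a
  point is \<open>a / c\<close> between them, \<open>c / a\<close> beyond 1, and
  \<open>- (a / b)\<close> below 0.\<close>

lemma thrice_punctured_line_points_subset:
  "thrice_punctured_line_points S \<subseteq>
    (\<lambda>(a, b). of_nat a / of_nat (a + b)) ` coprime_sums S \<union>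
    (\<lambda>(a, b). of_nat (a + b) / of_nat a) ` coprime_sums S \<union>
    (\<lambda>(a, b). - (of_nat a / of_nat b)) ` coprime_sums S"
proof
  fix x assume "x \<in> thrice_punctured_line_points S"
  then have x: "x \<in> S_units S" "1 - x \<in> S_units S"
    by (auto simp: thrice_punctured_line_points_def)
  obtain n d where nd: "quotient_of x = (n, d)" by fastforce
  have d: "0 < d" and cop: "coprime n d" and xeq: "x = of_int n / of_int d"
    using quotient_of_denom_pos[OF nd] quotient_of_coprime[OF nd] quotient_of_div[OF nd] by auto
  have x1: "1 - x = of_int (d - n) / of_int d"
    using d by (simp add: xeq field_simps)
  have cop': "coprime (d - n) d"
    using cop by (metis coprime_commute coprime_iff_gcd_eq_1 gcd_diff2)
  have "x \<noteq> 0" "x \<noteq> 1" using x by (auto simp: S_units_def)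
  then have n0: "n \<noteq> 0" "n \<noteq> d" using d by (auto simp: xeq)
  have sm: "p \<in> S" if "prime p" "int p dvd n * d * (d - n)" for p
  proof -
    have "int p dvd n * d \<or> int p dvd (d - n) * d"
      using that by (metis dvd_mult2 prime_dvd_mult_iff prime_nat_int_transfer)
    then show ?thesis
      using S_units_lowest_terms[OF x(1)[unfolded xeq] cop _ that(1)]
        S_units_lowest_terms[OF x(2)[unfolded x1] cop' _ that(1)] d by auto
  qed
  \<comment> \<open>In all three cases \<open>a * b * (a + b)\<close> is
    \<open>n * d * (d - n)\<close> up to sign, so its primes are checked only once.\<close>
  have mem: "(nat a, nat b) \<in> coprime_sums S"
    if "0 < a" "0 < b" "coprime a b" "\<bar>a * b * (a + b)\<bar> = \<bar>n * d * (d - n)\<bar>" for a b :: int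
  proof -
    have "p \<in> S" if "prime p" "p dvd nat a * nat b * (nat a + nat b)" for p
    proof (rule sm[OF \<open>prime p\<close>])
      have "int p dvd int (nat a * nat b * (nat a + nat b))"
        using that(2) by (simp only: int_dvd_int_iff)
      also have "int (nat a * nat b * (nat a + nat b)) = a * b * (a + b)"
        using \<open>0 < a\<close> \<open>0 < b\<close> by simp
      finally have "int p dvd a * b * (a + b)" .
      then show "int p dvd n * d * (d - n)"
        using \<open>\<bar>a * b * (a + b)\<bar> = \<bar>n * d * (d - n)\<bar>\<close> by (metis dvd_abs_iff)
    qed
    moreover have "coprime (nat a) (nat b)"
      using \<open>coprime a b\<close> \<open>0 < a\<close> \<open>0 < b\<close> by (simp flip: coprime_int_iff)
    ultimately show ?thesis using \<open>0 < a\<close> \<open>0 < b\<close> by (simp add: coprime_sums_def)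
  qed
  consider "0 < n" "n < d" | "d < n" | "n < 0" using n0 by linarith
  then show "x \<in> (\<lambda>(a, b). of_nat a / of_nat (a + b)) ` coprime_sums S \<union>
    (\<lambda>(a, b). of_nat (a + b) / of_nat a) ` coprime_sums S \<union>
    (\<lambda>(a, b). - (of_nat a / of_nat b)) ` coprime_sums S"
  proof cases
    case 1
    have "coprime n (d - n)"
      using cop by (metis coprime_commute coprime_iff_gcd_eq_1 gcd_diff1)
    then have "(nat n, nat (d - n)) \<in> coprime_sums S"
      by (intro mem) (use 1 in \<open>auto simp: algebra_simps\<close>)
    moreover have "x = (\<lambda>(a, b). of_nat a / of_nat (a + b)) (nat n, nat (d - n))"
      using 1 by (simp add: xeq)
    ultimately show ?thesis by blast
  next
    case 2
    have "coprime d (n - d)"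
      using cop by (metis coprime_commute coprime_iff_gcd_eq_1 gcd_diff1)
    then have "(nat d, nat (n - d)) \<in> coprime_sums S"
      using d 2 by (intro mem) (simp_all add: abs_mult abs_minus_commute)
    moreover have "x = (\<lambda>(a, b). of_nat (a + b) / of_nat a) (nat d, nat (n - d))"
      using 2 d by (simp add: xeq)
    ultimately show ?thesis by blast
  next
    case 3
    have "(nat (- n), nat d) \<in> coprime_sums S"
      using d 3 cop by (intro mem) (simp_all add: abs_mult)
    moreover have "x = (\<lambda>(a, b). - (of_nat a / of_nat b)) (nat (- n), nat d)"
      using 3 d by (simp add: xeq)
    ultimately show ?thesis by blast
  qed
qed

lemma card_thrice_punctured_line_points:
  assumes "finite (coprime_sums S)"
  shows "finite (thrice_punctured_line_points S) \<and>
    card (thrice_punctured_line_points S) \<le> 3 * card (coprime_sums S)"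
proof -
  let ?C = "coprime_sums S"
  let ?A = "(\<lambda>(a, b). of_nat a / of_nat (a + b)) ` ?C :: rat set"
  let ?B = "(\<lambda>(a, b). of_nat (a + b) / of_nat a) ` ?C :: rat set"
  let ?D = "(\<lambda>(a, b). - (of_nat a / of_nat b)) ` ?C :: rat set"
  have fin: "finite (?A \<union> ?B \<union> ?D)" using assms by simp
  have "card (thrice_punctured_line_points S) \<le> card (?A \<union> ?B \<union> ?D)"
    by (rule card_mono[OF fin thrice_punctured_line_points_subset])
  also have "\<dots> \<le> card ?A + card ?B + card ?D"
    by (meson add_le_mono1 card_Un_le le_trans)
  also have "\<dots> \<le> card ?C + card ?C + card ?C"
    by (intro add_mono card_image_le assms)
  finally show ?thesis
    using finite_subset[OF thrice_punctured_line_points_subset fin] by simp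
qed

section \<open>Comparison with the stated bound\<close>

text \<open>From \<open>15 * s + 1 \<le> 16 * s \<le> 2 * 2 ^ (s + 2)\<close>, the leading 2
  combines with \<open>3 ^ s\<close> to \<open>6 ^ s\<close>. The factor \<open>3 * 35 = 105\<close>
  is below \<open>8 * 2 ^ 4\<close>, and the remaining exponent \<open>(s + 2) * s + 4\<close> is at
  most \<open>4 ^ s\<close>.\<close>

lemma cell_count_le:
  fixes s :: nat
  assumes "2 \<le> s"
  shows "3 * (35 * (3 ^ s * (15 * s + 1) ^ s)) \<le> 8 * 6 ^ s * 2 ^ (4 ^ s)"
proof -
  have "s \<le> 2 ^ (s - 1)"
    using assms less_exp[of "s - 1"] by linarith
  then have "15 * s + 1 \<le> 2 ^ 4 * 2 ^ (s - 1)" using assms by simp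
  also have "\<dots> = 2 * 2 ^ (s + 2)"
    using assms by (cases s) auto
  finally have "(15 * s + 1) ^ s \<le> (2 * 2 ^ (s + 2)) ^ s" by (rule power_mono) simp
  also have "\<dots> = 2 ^ s * 2 ^ ((s + 2) * s)"
    by (simp only: power_mult_distrib power_mult)
  finally have 1: "(15 * s + 1) ^ s \<le> 2 ^ s * 2 ^ ((s + 2) * s)" .
  have 2: "(s + 2) * s + 4 \<le> 4 ^ s"
    using assms
  proof (induction s rule: dec_induct)
    case base
    show ?case by simp
  next
    case (step s)
    then have "(Suc s + 2) * Suc s + 4 \<le> 4 * ((s + 2) * s + 4)" by (simp add: algebra_simps)
    then show ?case using step.IH by simp
  qed
  have "3 * (35 * (3 ^ s * (15 * s + 1) ^ s)) \<le> 8 * 2 ^ 4 * (3 ^ s * (2 ^ s * 2 ^ ((s + 2) * s)))"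
    using mult_le_mono[OF _ mult_le_mono2[OF 1], of 105 "8 * 2 ^ 4" "3 ^ s"] by simp
  also have "\<dots> = 8 * (3 * 2) ^ s * 2 ^ ((s + 2) * s + 4)"
    by (simp only: power_mult_distrib power_add) (simp add: algebra_simps)
  also have "\<dots> \<le> 8 * 6 ^ s * 2 ^ (4 ^ s)"
    using 2 by (intro mult_le_mono power_increasing) auto
  finally show ?thesis .
qed

theorem theoremD:
  fixes s :: nat and S :: "nat set"
  assumes "\<And>p. p \<in> S \<Longrightarrow> prime p"
    and "finite S" and "card S = s"
  shows "finite (thrice_punctured_line_points S) \<and>
    card (thrice_punctured_line_points S) \<le> 8 * 6 ^ s * 2 ^ (4 ^ s)"
proof (cases "2 \<le> s")
  case True
  then have "S \<noteq> {}" using assms by auto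
  then have "finite (coprime_sums S) \<and>
      card (coprime_sums S) \<le> 35 * (3 ^ card S * (15 * card S + 1) ^ card S)"
    using assms by (intro card_coprime_sums) auto
  then show ?thesis
    using card_thrice_punctured_line_points[of S] cell_count_le[OF True] assms(3) by fastforce
next
  case False
  then have sub: "coprime_sums S \<subseteq> {(1, 1)}"
    using assms by (intro coprime_sums_card_le_1) auto
  then have "finite (coprime_sums S)" "card (coprime_sums S) \<le> 1"
    using finite_subset[OF sub] card_mono[OF _ sub] by auto
  moreover have "3 \<le> 8 * 6 ^ s * (2::nat) ^ (4 ^ s)"
  proof -
    have "8 * 1 * 1 \<le> 8 * 6 ^ s * (2::nat) ^ (4 ^ s)" by (intro mult_le_mono) auto
    then show ?thesis by linarith
  qed
  ultimately show ?thesis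
    using card_thrice_punctured_line_points[of S] by linarith
qed

end
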